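(* In every valid Septoku board $s$, the seven values $s(1), s(4), s(16), s(22), s(34), s(37)$ (at the six corners) and $s(19)$ (at the center) are pairwise distinct.
   Context: The Septoku board consists of 37 cells forming a regular hexagon of side 4 in a hexagonal grid, numbered row by row: $1$–$4$ (top row), $5$–$9$, $10$–$15$, $16$–$22$, $23$–$28$, $29$–$33$, $34$–$37$ (bottom row). The 21 "rows" of the board are: horizontal $\{1,2,3,4\}$, $\{5,\dots,9\}$, $\{10,\dots,15\}$, $\{16,\dots,22\}$, $\{23,\dots,28\}$, $\{29,\dots,33\}$, $\{34,\dots,37\}$; up-right $\{1,5,10,16\}$, $\{2,6,11,17,23\}$, $\{3,7,12,18,24,29\}$, $\{4,8,13,19,25,30,34\}$, $\{9,14,20,26,31,35\}$, $\{15,21,27,32,36\}$, $\{22,28,33,37\}$; down-right $\{4,9,15,22\}$, $\{3,8,14,21,28\}$, $\{2,7,13,20,27,33\}$, $\{1,6,12,19,26,32,37\}$, $\{5,11,18,25,31,36\}$, $\{10,17,24,30,35\}$, $\{16,23,29,34\}$. The seven "circles" are: $\{1,2,5,6,7,11,12\}$, $\{3,4,7,8,9,13,14\}$, $\{10,11,16,17,18,23,24\}$, $\{12,13,18,19,20,25,26\}$, $\{14,15,20,21,22,27,28\}$, $\{24,25,29,30,31,34,35\}$, $\{26,27,31,32,33,36,37\}$. A valid Septoku board is a map $s:\{1,\dots,37\}\to\{1,\dots,7\}$ such that the cells of each of the 21 rows receive pairwise distinct values and the seven cells of each circle receive pairwise distinct values. *)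

theory Defs
  imports "HOL-Library.FuncSet"
begin

text \<open>
  Cells are numbered \<open>1\<close> to \<open>37\<close> row by row, from top to bottom and from left to right in each row:
\<close>
(*
            1   2   3   4
          5   6   7   8   9
       10  11  12  13  14  15
     16  17  18  19  20  21  22
       23  24  25  26  27  28
         29  30  31  32  33
           34  35  36  37
*)

definition horizontal_rows :: "nat set set" where
  "horizontal_rows =
    {{1, 2, 3, 4},
     {5, 6, 7, 8, 9},
     {10, 11, 12, 13, 14, 15},
     {16, 17, 18, 19, 20, 21, 22},
     {23, 24, 25, 26, 27, 28},
     {29, 30, 31, 32, 33},
     {34, 35, 36, 37}}"

definition up_right_rows :: "nat set set" where
  "up_right_rows =
    {{1, 5, 10, 16},
     {2, 6, 11, 17, 23},
     {3, 7, 12, 18, 24, 29},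
     {4, 8, 13, 19, 25, 30, 34},
     {9, 14, 20, 26, 31, 35},
     {15, 21, 27, 32, 36},
     {22, 28, 33, 37}}"

definition down_right_rows :: "nat set set" where
  "down_right_rows =
    {{4, 9, 15, 22},
     {3, 8, 14, 21, 28},
     {2, 7, 13, 20, 27, 33},
     {1, 6, 12, 19, 26, 32, 37},
     {5, 11, 18, 25, 31, 36},
     {10, 17, 24, 30, 35},
     {16, 23, 29, 34}}"

definition septoku_rows :: "nat set set" where
  "septoku_rows = horizontal_rows \<union> up_right_rows \<union> down_right_rows"

definition septoku_circles :: "nat set set" where
  "septoku_circles =
    {{1, 2, 5, 6, 7, 11, 12},
     {3, 4, 7, 8, 9, 13, 14},
     {10, 11, 16, 17, 18, 23, 24},
     {12, 13, 18, 19, 20, 25, 26},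
     {14, 15, 20, 21, 22, 27, 28},
     {24, 25, 29, 30, 31, 34, 35},
     {26, 27, 31, 32, 33, 36, 37}}"

text \<open>
  A board is a total function on \<open>nat\<close>; its values outside \<open>{1..37}\<close> are irrelevant.
\<close>

definition valid_septoku :: "(nat \<Rightarrow> nat) \<Rightarrow> bool" where
  "valid_septoku s \<longleftrightarrow>
     s \<in> {1..37} \<rightarrow> {1..7} \<and>
     (\<forall>R\<in>septoku_rows. inj_on s R) \<and>
     (\<forall>C\<in>septoku_circles. inj_on s C)"

end

theory Submission
  imports Defs
begin

text \<open>
  Each value occurs exactly once in every line of seven cells (circle or long row). A short case
  analysis shows that a set of cells with this property and with at most one cell in every row
  contains a corner or the center. Hence all seven values occur among the seven corner and center
  cells, and so each occurs there only once.
\<close>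

lemmas septoku_lines_defs =
  septoku_rows_def horizontal_rows_def up_right_rows_def down_right_rows_def septoku_circles_def

text \<open>If no corner or center satisfies \<open>P\<close>, the cell of the middle circle that
  does is, by symmetry, \<open>12\<close>. The other two long rows then give \<open>17\<close> or
  \<open>21\<close>, and \<open>8\<close> or \<open>30\<close>. Here \<open>17\<close>,
  \<open>30\<close> share a row, as do \<open>8\<close>, \<open>21\<close>; \<open>8\<close>,
  \<open>17\<close> force both \<open>27\<close> and \<open>31\<close>, which lie in one circle;
  \<open>21\<close>, \<open>30\<close> block the circle of \<open>36\<close>.\<close>

lemma corner_or_center_if_transversal:
  fixes P :: "nat \<Rightarrow> bool"
  assumes unique: "\<forall>R\<in>septoku_rows \<union> septoku_circles. \<forall>x\<in>R. \<forall>y\<in>R. P x \<longrightarrow> P y \<longrightarrow> x = y"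
    and meets: "\<forall>R\<in>septoku_rows \<union> septoku_circles. card R = 7 \<longrightarrow> (\<exists>x\<in>R. P x)"
  shows "\<exists>x\<in>{1, 4, 16, 22, 34, 37, 19}. P x"
proof -
  have long: "\<exists>x\<in>{16, 17, 18, 19, 20, 21, 22}. P x"
    "\<exists>x\<in>{4, 8, 13, 19, 25, 30, 34}. P x"
    "\<exists>x\<in>{1, 6, 12, 19, 26, 32, 37}. P x"
    by (rule meets[rule_format]; simp add: septoku_lines_defs)+
  have circles: "\<forall>C\<in>septoku_circles. \<exists>x\<in>C. P x"
    using meets by (simp add: septoku_circles_def)
  have "P 1 \<or> P 4 \<or> P 16 \<or> P 22 \<or> P 34 \<or> P 37 \<or> P 19"
    \<comment> \<open>Folding keeps cell \<open>1\<close> from occurring both as \<open>1\<close> and as \<open>Suc 0\<close>, distinct atoms for the solver.\<close>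
    using unique[unfolded septoku_lines_defs, simplified, folded One_nat_def]
      circles[unfolded septoku_circles_def, simplified, folded One_nat_def]
      long[simplified, folded One_nat_def]
    by sat
  then show ?thesis by simp
qed

lemma valid_septoku_line:
  assumes "valid_septoku s" and "R \<in> septoku_rows \<union> septoku_circles"
  shows "inj_on s R" and "s ` R \<subseteq> {1..7}"
proof -
  show "inj_on s R"
    using assms by (auto simp: valid_septoku_def)
  have "\<forall>R\<in>septoku_rows \<union> septoku_circles. R \<subseteq> {1..37}"
    by (simp add: septoku_lines_defs)
  then show "s ` R \<subseteq> {1..7}"
    using assms by (fastforce simp: valid_septoku_def)
qed

text \<open>Pigeonhole: seven distinct values in \<open>{1..7}\<close> exhaust it.\<close>

lemma valid_septoku_line_surj:
  assumes "valid_septoku s" and "R \<in> septoku_rows \<union> septoku_circles" and "card R = 7"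
  shows "s ` R = {1..7}"
  using valid_septoku_line[OF assms(1,2)] assms(3)
  by (intro card_subset_eq) (simp_all add: card_image)

theorem theorem2:
  fixes s :: "nat \<Rightarrow> nat"
  assumes "valid_septoku s"
  shows "distinct [s 1, s 4, s 16, s 22, s 34, s 37, s 19]"
proof -
  let ?K = "{1, 4, 16, 22, 34, 37, 19} :: nat set"
  have "{1..7} \<subseteq> s ` ?K"
  proof
    fix v :: nat
    assume v: "v \<in> {1..7}"
    have "\<exists>x\<in>?K. s x = v"
    \<comment> \<open>The transversal is the set of cells holding \<open>v\<close>.\<close>
    proof (rule corner_or_center_if_transversal; intro ballI impI)
      fix R x y
      assume "R \<in> septoku_rows \<union> septoku_circles" "x \<in> R" "y \<in> R" "s x = v" "s y = v"
      then show "x = y"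
        using valid_septoku_line(1)[OF assms] by (metis inj_onD)
    next
      fix R :: "nat set"
      assume "R \<in> septoku_rows \<union> septoku_circles" "card R = 7"
      then show "\<exists>x\<in>R. s x = v"
        using valid_septoku_line_surj[OF assms] v by (metis imageE)
    qed
    then show "v \<in> s ` ?K" by blast
  qed
  then have "card {1..7::nat} \<le> card (s ` ?K)"
    by (intro card_mono) simp_all
  then have "card (set (map s [1, 4, 16, 22, 34, 37, 19])) \<ge> 7"
    by simp
  \<comment> \<open>\<open>card_length\<close> supplies the reverse bound, giving the equality that
    \<open>card_distinct\<close> needs.\<close>
  then show ?thesis
    using card_length[of "map s [1, 4, 16, 22, 34, 37, 19]"]
    by (intro card_distinct) simp
qed

end
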